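(* Let $F$ be an $r$-graph with $r,|F|\ge 2$. Suppose there exist $C>0$ and positive functions $M=M(n)$ and $\tau=\tau(n,m)$ such that (a) $F$ is $(M,(\log n)^{C},\tau)$-balanced, and (b) for all sufficiently large $n$ and $m\ge M(n)$, the function $\tau(n,m)$ is non-increasing with respect to $m$ and satisfies $\tau(n,m)\ge 1$. Then there exists $C'\ge 0$ such that for all sufficiently large $n$, all $m=m(n)\ge M(n)$, and all $0<p=p(n)\le 1$ with $pm\to\infty$ as $n\to\infty$, we have a.a.s. $$\mathrm{ex}(G^r_{n,p},F)\le \max\left\{C'pm,\ \tau(n,m)(\log n)^{C'}\right\}.$$
   Context: An $r$-graph is a finite $r$-uniform hypergraph; $|F|$ is the number of edges of $F$. For a hypergraph $\mathcal{H}$ and $S\subseteq V(\mathcal{H})$, $\deg_{\mathcal{H}}(S)$ is the number of edges of $\mathcal{H}$ containing $S$, and $\Delta_i(\mathcal{H})=\max\{\deg_{\mathcal{H}}(S): S\subseteq V(\mathcal{H}),|S|=i\}$. Given positive functions $M=M(n)$, $\gamma=\gamma(n)$, $\tau=\tau(n,m)$, an $r$-graph $F$ is $(M,\gamma,\tau)$-balanced if for every $n$-vertex $m$-edge $r$-graph $H$ with $n$ sufficiently large and $m\ge M(n)$, there exists a non-empty collection $\mathcal{H}$ of copies of $F$ in $H$ (viewed as an $|F|$-uniform hypergraph on vertex set $E(H)$) such that for all integers $1\le i\le |F|$, $$\Delta_i(\mathcal{H})\le \frac{\gamma(n)|\mathcal{H}|}{m}\left(\frac{\tau(n,m)}{m}\right)^{i-1}.$$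 $G^r_{n,p}$ is the random $r$-graph on $n$ vertices in which each $r$-set is an edge independently with probability $p$. $\mathrm{ex}(G^r_{n,p},F)$ is the maximum number of edges in an $F$-free subgraph of $G^r_{n,p}$. Events $A_n$ hold a.a.s. if $\Pr[A_n]\to1$ as $n\to\infty$. *)

theory Defs
  imports "HOL-Probability.Probability" "HOL-Library.Ramsey"
begin

text \<open>
  A hypergraph is a pair of a vertex set and an edge set.  Edges are sets, so there are
  no multiple edges; well-formedness is imposed by \<open>rgraph\<close>.
\<close>

type_synonym 'a hypergraph = "'a set \<times> 'a set set"

abbreviation verts :: "'a hypergraph \<Rightarrow> 'a set" where
  "verts H \<equiv> fst H"

abbreviation edges :: "'a hypergraph \<Rightarrow> 'a set set" where
  "edges H \<equiv> snd H"

definition rgraph :: "nat \<Rightarrow> 'a hypergraph \<Rightarrow> bool" where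
  "rgraph r H \<longleftrightarrow> finite (verts H) \<and> edges H \<subseteq> [verts H]\<^bsup>r\<^esup>"

definition deg :: "'a hypergraph \<Rightarrow> 'a set \<Rightarrow> nat" where
  "deg H S = card {e \<in> edges H. S \<subseteq> e}"

definition max_deg :: "'a hypergraph \<Rightarrow> nat \<Rightarrow> nat" where
  "max_deg H i = Max (deg H ` [verts H]\<^bsup>i\<^esup>)"

definition subgraph :: "'a hypergraph \<Rightarrow> 'a hypergraph \<Rightarrow> bool" where
  "subgraph G H \<longleftrightarrow>
     verts G \<subseteq> verts H \<and> edges G \<subseteq> edges H \<and> edges G \<subseteq> Pow (verts G)"

definition isomorphic :: "'a hypergraph \<Rightarrow> 'b hypergraph \<Rightarrow> bool" where
  "isomorphic F G \<longleftrightarrow>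
     (\<exists>\<phi>. bij_betw \<phi> (verts F) (verts G) \<and> edges G = (\<lambda>e. \<phi> ` e) ` edges F)"

text \<open>
  A copy of \<open>F\<close> in \<open>H\<close> is recorded by its edge set, i.e. as a set of edges of \<open>H\<close>, so that a
  collection of copies is the edge set of a hypergraph with vertex set \<open>edges H\<close>.
  Isolated vertices of \<open>F\<close> still have to find room in \<open>H\<close>.
\<close>

definition copies :: "'a hypergraph \<Rightarrow> 'b hypergraph \<Rightarrow> 'b set set set" where
  "copies F H = {edges G | G. subgraph G H \<and> isomorphic F G}"

text \<open>
  The host graphs \<open>H\<close> have natural numbers as vertices; up to isomorphism these are all
  finite hypergraphs.  In \<open>max_deg\<close> the maximum is over a non-empty set, because a
  non-empty \<open>\<C>\<close> forces \<open>card (edges F) \<le> card (edges H)\<close>.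
\<close>

definition balanced ::
  "nat \<Rightarrow> 'a hypergraph \<Rightarrow> (nat \<Rightarrow> real) \<Rightarrow> (nat \<Rightarrow> real) \<Rightarrow> (nat \<Rightarrow> nat \<Rightarrow> real) \<Rightarrow> bool" where
  "balanced r F M \<gamma> \<tau> \<longleftrightarrow>
     (\<forall>\<^sub>F n in sequentially. \<forall>m. \<forall>H :: nat hypergraph.
        rgraph r H \<and> card (verts H) = n \<and> card (edges H) = m \<and> real m \<ge> M n \<longrightarrow>
        (\<exists>\<C>. \<C> \<subseteq> copies F H \<and> \<C> \<noteq> {} \<and>
          (\<forall>i\<in>{1..card (edges F)}.
             real (max_deg (edges H, \<C>) i)
               \<le> \<gamma> n * real (card \<C>) / real m * (\<tau> n m / real m) ^ (i - 1))))"

definition ex :: "'b hypergraph \<Rightarrow> 'a hypergraph \<Rightarrow> nat" where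
  "ex G F = Max {card (edges G') | G'. subgraph G' G \<and> copies F G' = {}}"

definition random_rgraph :: "nat \<Rightarrow> nat \<Rightarrow> real \<Rightarrow> nat hypergraph pmf" where
  "random_rgraph r n p =
     map_pmf (\<lambda>X. ({..<n}, {e \<in> [{..<n}]\<^bsup>r\<^esup>. X e}))
       (Pi_pmf ([{..<n}]\<^bsup>r\<^esup>) False (\<lambda>_. bernoulli_pmf p))"

end

theory Submission imports Defs
begin

text \<open>
  A subgraph of \<open>G\<close> with more than \<open>s\<close> edges and no copy of \<open>F\<close> should be unlikely when \<open>s\<close> is a
  large multiple of \<open>p * m\<close>: any fixed set of fewer than \<open>m\<close> potential edges meets the random
  graph in more than \<open>s\<close> edges with probability only \<open>exp (2 * p * m - s)\<close>
  (\<open>prob_binomial_upper_tail\<close>).  A union bound over all edge sets without a copy of \<open>F\<close> is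
  hopeless, because there are too many of them.  But they cluster: they are all covered by few sets
  with fewer than \<open>m\<close> elements, called containers (\<open>small_containers_of_balanced\<close>).
  Roughly \<open>exp (\<tau> * polylog n)\<close> containers suffice, so the union bound over the containers
  costs at most \<open>exp (s / 4)\<close> once \<open>s \<ge> \<tau> * (ln n) powr C'\<close>.

  Containers arise by repeated shrinking.  As long as a container has at least \<open>m\<close> elements, it is
  the edge set of a host graph to which balancedness applies.  The resulting collection of copies
  is a uniform hypergraph, on the set of edges of the host, whose degrees are well spread.  The
  container lemma (\<open>container_lemma\<close>) replaces the container by \<open>(N + 1) ^ O(\<tau>)\<close> smaller ones,
  \<open>N\<close> being the number of all potential edges; each is smaller by a factor \<open>1 - 1 / (\<kappa> * \<gamma>)\<close> with
  \<open>\<gamma> = (ln n) powr C\<close>.  Since \<open>\<tau>\<close> is non-increasing in the number of edges, its value at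
  \<open>m\<close> is good enough at every stage, and \<open>O(\<gamma> * ln n)\<close> stages bring the size below \<open>m\<close>
  (\<open>containers_iterate\<close>, \<open>container_numerics\<close>).

  The container lemma is proved for weighted hypergraphs, by induction on the uniformity.  Given a
  \<open>(k+1)\<close>-uniform weight \<open>w\<close>, a \<open>k\<close>-uniform weight \<open>g\<close> is built up from links of vertices of the
  independent set \<open>I\<close>: \<open>I\<close> stays independent for \<open>g\<close>.  A subset whose degree in \<open>g\<close> exceeds a
  threshold is saturated, and later links omit the edges above it, so \<open>g\<close> remains well spread.  If at
  some moment no vertex of \<open>I\<close> has a link of substantial weight, then \<open>I\<close> lies in the set of all
  vertices with a light link, which depends only on \<open>g\<close> and is small by double counting
  (\<open>few_light_links\<close>).  Otherwise \<open>g\<close> becomes heavy after \<open>b\<close> links, and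
  the induction hypothesis applies to \<open>g\<close>.  The number of containers is controlled because at every
  step there are at most \<open>card V + 1\<close> possibilities.
\<close>

section \<open>Families of containers\<close>

text \<open>
  \<open>\<I>\<close> is the collection of independent sets, \<open>B\<close> bounds the number of containers and
  \<open>P\<close> expresses that a container is small.
\<close>

definition containers :: "'a set set \<Rightarrow> nat \<Rightarrow> ('a set \<Rightarrow> bool) \<Rightarrow> 'a set \<Rightarrow> bool" where
  "containers \<I> B P V \<longleftrightarrow>
     (\<exists>\<C>. finite \<C> \<and> card \<C> \<le> B \<and> (\<forall>C\<in>\<C>. C \<subseteq> V \<and> P C) \<and>
          (\<forall>I\<in>\<I>. I \<subseteq> V \<longrightarrow> (\<exists>C\<in>\<C>. I \<subseteq> C)))"

lemma containers_single:
  assumes "A \<subseteq> V" "P A" "B \<ge> 1" "\<And>I. I \<in> \<I> \<Longrightarrow> I \<subseteq> V \<Longrightarrow> I \<subseteq> A"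
  shows "containers \<I> B P V"
  unfolding containers_def by (rule exI[of _ "{A}"]) (use assms in auto)

lemma containers_mono:
  assumes "containers \<I> B P V" "\<J> \<subseteq> \<I>" "B \<le> B'" "\<And>C. P C \<Longrightarrow> Q C"
  shows "containers \<J> B' Q V"
proof -
  obtain \<C> where "finite \<C>" "card \<C> \<le> B" "\<forall>C\<in>\<C>. C \<subseteq> V \<and> P C"
      "\<forall>I\<in>\<I>. I \<subseteq> V \<longrightarrow> (\<exists>C\<in>\<C>. I \<subseteq> C)"
    using assms(1) unfolding containers_def by blast
  then show ?thesis
    unfolding containers_def by (intro exI[of _ \<C>]) (use assms in fastforce)
qed

text \<open>
  Every recursive construction of containers has this form: a choice \<open>x\<close> is made depending on
  \<open>I\<close>, and afterwards \<open>I\<close> belongs to the smaller class \<open>\<J> x\<close> or lies in the smaller set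
  \<open>U x\<close>.
\<close>

lemma containers_branch:
  assumes fin: "finite X"
    and sub: "\<And>x. x \<in> X \<Longrightarrow> containers (\<J> x) B P (U x)" "\<And>x. x \<in> X \<Longrightarrow> U x \<subseteq> V"
    and cover: "\<And>I. I \<in> \<I> \<Longrightarrow> I \<subseteq> V \<Longrightarrow> \<exists>x\<in>X. I \<in> \<J> x \<and> I \<subseteq> U x"
  shows "containers \<I> (card X * B) P V"
proof -
  have "\<forall>x\<in>X. \<exists>\<C>. finite \<C> \<and> card \<C> \<le> B \<and> (\<forall>C\<in>\<C>. C \<subseteq> U x \<and> P C) \<and>
          (\<forall>I\<in>\<J> x. I \<subseteq> U x \<longrightarrow> (\<exists>C\<in>\<C>. I \<subseteq> C))"
    using sub(1) unfolding containers_def by (intro ballI)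
  from bchoice[OF this] obtain c where
    c: "\<And>x. x \<in> X \<Longrightarrow> finite (c x)" "\<And>x. x \<in> X \<Longrightarrow> card (c x) \<le> B"
       "\<And>x C. x \<in> X \<Longrightarrow> C \<in> c x \<Longrightarrow> C \<subseteq> U x \<and> P C"
       "\<And>x I. x \<in> X \<Longrightarrow> I \<in> \<J> x \<Longrightarrow> I \<subseteq> U x \<Longrightarrow> \<exists>C\<in>c x. I \<subseteq> C"
    by metis
  show ?thesis
    unfolding containers_def
  proof (intro exI[of _ "\<Union>x\<in>X. c x"] conjI)
    show "finite (\<Union>x\<in>X. c x)" using fin c(1) by blast
    have "card (\<Union>x\<in>X. c x) \<le> (\<Sum>x\<in>X. card (c x))" by (rule card_UN_le[OF fin])
    also have "\<dots> \<le> card X * B" using c(2) by (rule sum_bounded_above[of X "\<lambda>x. card (c x)" B, simplified])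
    finally show "card (\<Union>x\<in>X. c x) \<le> card X * B" .
    show "\<forall>C\<in>\<Union>x\<in>X. c x. C \<subseteq> V \<and> P C" using c(3) sub(2) by blast
    show "\<forall>I\<in>\<I>. I \<subseteq> V \<longrightarrow> (\<exists>C\<in>\<Union>x\<in>X. c x. I \<subseteq> C)"
    proof (intro ballI impI)
      fix I assume "I \<in> \<I>" "I \<subseteq> V"
      then obtain x where "x \<in> X" "I \<in> \<J> x" "I \<subseteq> U x" using cover by blast
      with c(4)[OF this] show "\<exists>C\<in>\<Union>x\<in>X. c x. I \<subseteq> C" by blast
    qed
  qed
qed

text \<open>
  Containers with at least \<open>m\<close> elements are replaced by smaller ones, in \<open>t\<close> rounds; the others are kept.
\<close>

lemma containers_iterate:
  fixes \<delta> :: real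
  assumes "finite U" and "B \<ge> 1" and "\<delta> \<le> 1"
    and step: "\<And>C. C \<subseteq> U \<Longrightarrow> card C \<ge> m \<Longrightarrow>
                containers \<I> B (\<lambda>D. card D \<le> (1 - \<delta>) * card C) C"
  shows "C \<subseteq> U \<Longrightarrow> containers \<I> (B ^ t) (\<lambda>D. card D < m \<or> card D \<le> (1 - \<delta>) ^ t * card C) C"
proof (induction t arbitrary: C)
  case 0
  show ?case by (rule containers_single[of C]) auto
next
  case (Suc t)
  show ?case
  proof (cases "card C < m")
    case True
    then show ?thesis using \<open>B \<ge> 1\<close> by (intro containers_single[of C] order.refl) auto
  next
    case False
    with step[OF Suc.prems] obtain \<D> where
      D: "finite \<D>" "card \<D> \<le> B" "\<And>D. D \<in> \<D> \<Longrightarrow> D \<subseteq> C \<and> card D \<le> (1 - \<delta>) * card C"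
         "\<And>I. I \<in> \<I> \<Longrightarrow> I \<subseteq> C \<Longrightarrow> \<exists>D\<in>\<D>. I \<subseteq> D"
      unfolding containers_def by (metis not_less)
    have "containers \<I> (card \<D> * B ^ t) (\<lambda>D. card D < m \<or> card D \<le> (1 - \<delta>) ^ Suc t * card C) C"
    proof (rule containers_branch[where \<J> = "\<lambda>_. \<I>" and U = "\<lambda>D. D"])
      fix D assume "D \<in> \<D>"
      with D(3) have DC: "D \<subseteq> C" "card D \<le> (1 - \<delta>) * card C" by auto
      have "(1 - \<delta>) ^ t * card D \<le> (1 - \<delta>) ^ Suc t * card C"
        using mult_left_mono[OF DC(2), of "(1 - \<delta>) ^ t"] \<open>\<delta> \<le> 1\<close> by (simp add: mult_ac)
      moreover have "containers \<I> (B ^ t) (\<lambda>E. card E < m \<or> card E \<le> (1 - \<delta>) ^ t * card D) D"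
        by (rule Suc.IH) (use DC(1) Suc.prems in blast)
      ultimately show "containers \<I> (B ^ t) (\<lambda>D. card D < m \<or> card D \<le> (1 - \<delta>) ^ Suc t * card C) D"
        by (elim containers_mono) auto
    qed (use D in auto)
    moreover have "card \<D> * B ^ t \<le> B ^ Suc t" using D(2) by simp
    ultimately show ?thesis
      by (rule containers_mono[OF _ order.refl])
  qed
qed

section \<open>Weighted hypergraphs\<close>

definition uniform_weight :: "'a set \<Rightarrow> nat \<Rightarrow> ('a set \<Rightarrow> real) \<Rightarrow> bool" where
  "uniform_weight V k w \<longleftrightarrow> (\<forall>e. 0 \<le> w e \<and> (w e \<noteq> 0 \<longrightarrow> e \<subseteq> V \<and> card e = k))"

text \<open>The degree of the empty set is the total weight.\<close>

definition wdeg :: "'a set \<Rightarrow> ('a set \<Rightarrow> real) \<Rightarrow> 'a set \<Rightarrow> real" where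
  "wdeg V w T = (\<Sum>e | e \<subseteq> V \<and> T \<subseteq> e. w e)"

text \<open>
  This is the hypothesis of the container lemma: an \<open>i\<close>-set has degree at most \<open>K\<close> times
  the average degree of a vertex (up to a factor depending on the uniformity), times
  \<open>(b / card V) ^ (i - 1)\<close>.  The number \<open>b\<close> is the number of vertices
  of an independent set whose links suffice to build the auxiliary hypergraph of lower uniformity.
\<close>

definition spread :: "'a set \<Rightarrow> nat \<Rightarrow> real \<Rightarrow> ('a set \<Rightarrow> real) \<Rightarrow> bool" where
  "spread V b K w \<longleftrightarrow>
     (\<forall>T\<subseteq>V. T \<noteq> {} \<longrightarrow>
        wdeg V w T \<le> K * wdeg V w {} / card V * (real b / card V) ^ (card T - 1))"

definition edge_free :: "('a set \<Rightarrow> real) \<Rightarrow> 'a set set" where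
  "edge_free w = {I. \<forall>e. w e \<noteq> 0 \<longrightarrow> \<not> e \<subseteq> I}"

text \<open>
  The weight of the link of \<open>x\<close>, without the edges containing a member of \<open>\<S>\<close>.
\<close>

definition link :: "'a set \<Rightarrow> 'a set set \<Rightarrow> ('a set \<Rightarrow> real) \<Rightarrow> 'a \<Rightarrow> 'a set \<Rightarrow> real" where
  "link V \<S> w x f = (if f \<subseteq> V \<and> x \<notin> f \<and> (\<forall>T\<in>\<S>. \<not> T \<subseteq> f) then w (insert x f) else 0)"

lemma wdeg_nonneg: "uniform_weight V k w \<Longrightarrow> 0 \<le> wdeg V w T"
  unfolding wdeg_def uniform_weight_def by (intro sum_nonneg) auto

lemma wdeg_add: "wdeg V (\<lambda>e. g e + h e) T = wdeg V g T + wdeg V h T"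
  unfolding wdeg_def by (rule sum.distrib)

lemma uniform_weight_add:
  "uniform_weight V k g \<Longrightarrow> uniform_weight V k h \<Longrightarrow> uniform_weight V k (\<lambda>e. g e + h e)"
  unfolding uniform_weight_def by (auto simp: add_nonneg_eq_0_iff)

lemma uniform_weight_link:
  assumes "finite V" "x \<in> V" "uniform_weight V (Suc k) w"
  shows "uniform_weight V k (link V \<S> w x)"
  unfolding uniform_weight_def
proof (intro allI conjI impI)
  fix f
  show "0 \<le> link V \<S> w x f" using assms(3) by (auto simp: link_def uniform_weight_def)
  assume "link V \<S> w x f \<noteq> 0"
  then have f: "f \<subseteq> V" "x \<notin> f" "w (insert x f) \<noteq> 0" by (auto simp: link_def split: if_splits)
  then show "f \<subseteq> V" by simp
  have "card (insert x f) = Suc k" using f(3) assms(3) by (auto simp: uniform_weight_def)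
  then show "card f = k" using f(1,2) finite_subset[OF _ assms(1)] by (simp add: card_insert_if)
qed

lemma wdeg_link_mem: "x \<in> T \<Longrightarrow> wdeg V (link V \<S> w x) T = 0"
  unfolding wdeg_def link_def by (intro sum.neutral) auto

lemma wdeg_link_saturated: "T \<in> \<S> \<Longrightarrow> wdeg V (link V \<S> w x) T = 0"
  unfolding wdeg_def link_def by (intro sum.neutral) auto

lemma wdeg_link_le:
  assumes "finite V" "x \<in> V" "uniform_weight V k w"
  shows "wdeg V (link V \<S> w x) T \<le> wdeg V w (insert x T)"
proof -
  let ?F = "{f. f \<subseteq> V \<and> T \<subseteq> f \<and> x \<notin> f}"
  have nn: "0 \<le> w e" for e using assms(3) by (simp add: uniform_weight_def)
  have "wdeg V (link V \<S> w x) T = (\<Sum>f\<in>?F. link V \<S> w x f)"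
    unfolding wdeg_def by (rule sum.mono_neutral_right) (use assms(1) in \<open>auto simp: link_def\<close>)
  also have "\<dots> \<le> (\<Sum>f\<in>?F. w (insert x f))"
    by (intro sum_mono) (auto simp: link_def nn)
  also have "\<dots> = (\<Sum>e\<in>insert x ` ?F. w e)"
    by (subst sum.reindex) (auto simp: inj_on_def)
  also have "\<dots> \<le> wdeg V w (insert x T)"
    unfolding wdeg_def by (rule sum_mono2) (use assms nn in auto)
  finally show ?thesis .
qed

text \<open>Double counting: an edge of a \<open>k\<close>-uniform weight contributes to the degrees of its \<open>2 ^ k\<close> subsets.\<close>

lemma sum_wdeg:
  assumes "finite V" "uniform_weight V k g"
  shows "(\<Sum>T\<in>Pow V. wdeg V g T) = 2 ^ k * wdeg V g {}"
proof -
  have "(\<Sum>T\<in>Pow V. wdeg V g T) = (\<Sum>T\<in>Pow V. \<Sum>e | e \<in> Pow V \<and> T \<subseteq> e. g e)"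
    unfolding wdeg_def by simp
  also have "\<dots> = (\<Sum>e\<in>Pow V. \<Sum>T | T \<in> Pow V \<and> T \<subseteq> e. g e)"
    by (rule sum.swap_restrict) (use assms in auto)
  also have "\<dots> = (\<Sum>e\<in>Pow V. 2 ^ k * g e)"
  proof (rule sum.cong[OF refl])
    fix e assume e: "e \<in> Pow V"
    then have "{T. T \<in> Pow V \<and> T \<subseteq> e} = Pow e" by auto
    moreover have "finite e" using e assms(1) finite_subset by auto
    ultimately show "(\<Sum>T | T \<in> Pow V \<and> T \<subseteq> e. g e) = 2 ^ k * g e"
      using assms(2) by (cases "g e = 0") (auto simp: card_Pow uniform_weight_def)
  qed
  also have "\<dots> = 2 ^ k * wdeg V g {}"
    unfolding wdeg_def by (simp add: sum_distrib_left Pow_def)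
  finally show ?thesis .
qed

text \<open>
  Every edge above no member of \<open>\<S>\<close> survives in the link of each of its vertices, so deleting
  \<open>\<S>\<close> costs at most the total degree of the members of \<open>\<S>\<close>.
\<close>

lemma sum_link_ge:
  assumes V: "finite V" and w: "uniform_weight V (Suc k) w" and S: "\<S> \<subseteq> Pow V"
  shows "wdeg V w {} - (\<Sum>T\<in>\<S>. wdeg V w T) \<le> (\<Sum>x\<in>V. wdeg V (link V \<S> w x) {})"
proof -
  have nn: "0 \<le> w e" for e using w by (simp add: uniform_weight_def)
  have finS: "finite \<S>" using S V finite_subset by blast
  let ?bad = "{e. e \<subseteq> V \<and> (\<exists>T\<in>\<S>. T \<subseteq> e)}"
  let ?good = "{e. e \<subseteq> V \<and> (\<forall>T\<in>\<S>. \<not> T \<subseteq> e) \<and> w e \<noteq> 0}"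
  have "wdeg V w {} = (\<Sum>e | e \<subseteq> V. w e)" by (simp add: wdeg_def)
  also have "\<dots> = (\<Sum>e\<in>?bad \<union> ?good. w e)"
    by (rule sum.mono_neutral_right) (use V in auto)
  also have "\<dots> = (\<Sum>e\<in>?bad. w e) + (\<Sum>e\<in>?good. w e)"
    by (rule sum.union_disjoint) (use V in auto)
  finally have split: "wdeg V w {} = (\<Sum>e\<in>?bad. w e) + (\<Sum>e\<in>?good. w e)" .
  have "(\<Sum>e\<in>?bad. w e) \<le> (\<Sum>(T, e)\<in>Sigma \<S> (\<lambda>T. {e. e \<subseteq> V \<and> T \<subseteq> e}). w e)"
    by (rule sum_le_included[where i = snd]) (use V finS nn in \<open>auto intro!: finite_SigmaI\<close>)
  also have "\<dots> = (\<Sum>T\<in>\<S>. wdeg V w T)"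
    unfolding wdeg_def by (rule sum.Sigma[symmetric]) (use V finS in auto)
  finally have bad: "(\<Sum>e\<in>?bad. w e) \<le> (\<Sum>T\<in>\<S>. wdeg V w T)" .
  have "(\<Sum>e\<in>?good. w e) \<le> (\<Sum>(x, f)\<in>Sigma V (\<lambda>_. {f. f \<subseteq> V \<and> {} \<subseteq> f}). link V \<S> w x f)"
  proof (rule sum_le_included[where i = "\<lambda>(x, f). insert x f"])
    show "\<forall>e\<in>?good. \<exists>y\<in>Sigma V (\<lambda>_. {f. f \<subseteq> V \<and> {} \<subseteq> f}).
            (case y of (x, f) \<Rightarrow> insert x f) = e \<and> w e \<le> (case y of (x, f) \<Rightarrow> link V \<S> w x f)"
    proof
      fix e assume e: "e \<in> ?good"
      then have "card e = Suc k" using w by (auto simp: uniform_weight_def)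
      then obtain x where x: "x \<in> e" by fastforce
      then have "link V \<S> w x (e - {x}) = w e"
        using e by (auto simp: link_def insert_absorb)
      then show "\<exists>y\<in>Sigma V (\<lambda>_. {f. f \<subseteq> V \<and> {} \<subseteq> f}).
            (case y of (x, f) \<Rightarrow> insert x f) = e \<and> w e \<le> (case y of (x, f) \<Rightarrow> link V \<S> w x f)"
        using x e by (intro bexI[of _ "(x, e - {x})"]) auto
    qed
  qed (use V nn in \<open>auto simp: link_def\<close>)
  also have "\<dots> = (\<Sum>x\<in>V. wdeg V (link V \<S> w x) {})"
    unfolding wdeg_def by (rule sum.Sigma[symmetric]) (use V in auto)
  finally show ?thesis using split bad by linarith
qed

section \<open>The container lemma\<close>

definition saturated :: "'a set \<Rightarrow> real \<Rightarrow> real \<Rightarrow> ('a set \<Rightarrow> real) \<Rightarrow> 'a set set" where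
  "saturated V c q g = {T. T \<subseteq> V \<and> T \<noteq> {} \<and> c * q ^ card T < wdeg V g T}"

text \<open>
  If \<open>v - a\<close> vertices, each of degree at most \<open>K * W / v\<close>, carry a weight of at least
  \<open>W / c\<close>, then \<open>a\<close> is bounded away from \<open>v\<close>.
\<close>

lemma complement_bound:
  fixes W v a K c :: real
  assumes "W > 0" "v > 0" "K > 0" "c > 0" and le: "W / c \<le> (v - a) * (K * W / v)"
  shows "a \<le> (1 - 1 / (c * K)) * v"
proof -
  have "W * (1 / c) \<le> W * ((v - a) * K / v)" using le by (simp add: mult_ac)
  then have "1 / c \<le> (v - a) * K / v" using \<open>W > 0\<close> by (rule mult_left_le_imp_le)
  then show ?thesis using assms(2-4) by (simp add: field_simps)
qed

text \<open>
  Vertices with a light link form a small set as long as \<open>g\<close> is light.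
  Saturated sets have large degree in \<open>g\<close>, and \<open>w\<close> is well spread, so the total degree
  in \<open>w\<close> of the saturated sets is bounded by a multiple of the total degree in \<open>g\<close> of all sets;
  the threshold is chosen such that this amounts to at most half of the weight of \<open>w\<close>.  The other half
  is distributed over the links of all vertices.  Light links account for at most a quarter, and
  every other vertex has a link of weight at most \<open>K\<close> times the average, so many vertices are
  needed for the remaining quarter.
\<close>

lemma few_light_links:
  fixes K :: real
  assumes V: "finite V" "V \<noteq> {}" and b: "b \<ge> 1" and K: "K > 0"
    and w: "uniform_weight V (Suc k) w" "wdeg V w {} > 0" "spread V b K w"
    and g: "uniform_weight V k g"
    and light: "wdeg V g {} < real b / card V * wdeg V w {} / 4"
    and S: "\<S> = saturated V (2 ^ Suc k / 4 * (K * wdeg V w {} / card V)) (real b / card V) g"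
  shows "card {x\<in>V. wdeg V (link V \<S> w x) {} < wdeg V w {} / (4 * real (card V))}
          \<le> (1 - 1 / (4 * K)) * card V"
proof -
  define W v q where "W = wdeg V w {}" and "v = real (card V)" and "q = real b / card V"
  have pos: "W > 0" "v > 0" "q > 0" using V b w(2) by (auto simp: W_def v_def q_def card_gt_0_iff)
  let ?c = "2 ^ Suc k / 4 * (K * W / v)"
  have S': "\<S> = {T. T \<subseteq> V \<and> T \<noteq> {} \<and> ?c * q ^ card T < wdeg V g T}"
    unfolding S saturated_def W_def v_def q_def ..
  have spread: "wdeg V w T \<le> K * W / v * q ^ (card T - 1)" if "T \<subseteq> V" "T \<noteq> {}" for T
    using w(3) that unfolding spread_def W_def v_def q_def by auto
  have "wdeg V w T \<le> 2 / (2 ^ k * q) * wdeg V g T" if "T \<in> \<S>" for T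
  proof -
    have T: "T \<subseteq> V" "T \<noteq> {}" "?c * q ^ card T < wdeg V g T" using that S' by auto
    then have "card T > 0" using V(1) finite_subset by (auto simp: card_gt_0_iff)
    then have "q ^ card T = q * q ^ (card T - 1)" by (cases "card T") auto
    then have "K * W / v * q ^ (card T - 1) = 2 / (2 ^ k * q) * (?c * q ^ card T)"
      using pos by (simp add: field_simps)
    also have "\<dots> \<le> 2 / (2 ^ k * q) * wdeg V g T"
      using T(3) pos by (intro mult_left_mono) auto
    finally show ?thesis using spread[OF T(1,2)] by linarith
  qed
  then have "(\<Sum>T\<in>\<S>. wdeg V w T) \<le> (\<Sum>T\<in>\<S>. 2 / (2 ^ k * q) * wdeg V g T)" by (rule sum_mono)
  also have "\<dots> = 2 / (2 ^ k * q) * (\<Sum>T\<in>\<S>. wdeg V g T)" by (simp add: sum_distrib_left)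
  also have "\<dots> \<le> 2 / (2 ^ k * q) * (\<Sum>T\<in>Pow V. wdeg V g T)"
    by (intro mult_left_mono sum_mono2) (use V S' wdeg_nonneg[OF g] pos in auto)
  also have "\<dots> = 2 / q * wdeg V g {}" using sum_wdeg[OF V(1) g] by simp
  also have "\<dots> \<le> 2 / q * (q * W / 4)"
    using light pos by (intro mult_left_mono) (auto simp: q_def W_def)
  also have "\<dots> = W / 2" using pos by simp
  finally have lost: "(\<Sum>T\<in>\<S>. wdeg V w T) \<le> W / 2" .
  let ?gain = "\<lambda>x. wdeg V (link V \<S> w x) {}"
  let ?A = "{x\<in>V. ?gain x < W / (4 * v)}"
  have gain_le: "?gain x \<le> K * W / v" if "x \<in> V" for x
    using wdeg_link_le[OF V(1) that w(1), of \<S> "{}"] spread[of "{x}"] that by simp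
  have "W / 2 \<le> (\<Sum>x\<in>V. ?gain x)"
    using sum_link_ge[OF V(1) w(1), of \<S>] lost S' unfolding W_def by fastforce
  also have "\<dots> = (\<Sum>x\<in>?A. ?gain x) + (\<Sum>x\<in>V - ?A. ?gain x)"
    using V(1) by (subst sum.union_disjoint[symmetric]) (auto intro!: sum.cong)
  also have "(\<Sum>x\<in>?A. ?gain x) \<le> card ?A * (W / (4 * v))"
    by (rule sum_bounded_above) auto
  also have "(\<Sum>x\<in>V - ?A. ?gain x) \<le> card (V - ?A) * (K * W / v)"
    by (rule sum_bounded_above) (use gain_le in auto)
  also have "real (card (V - ?A)) = v - card ?A"
    using V(1) by (subst card_Diff_subset) (auto simp: v_def of_nat_diff card_mono)
  also have "card ?A * (W / (4 * v)) \<le> v * (W / (4 * v))"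
    using V(1) pos by (intro mult_right_mono) (auto simp: v_def card_mono)
  also have "v * (W / (4 * v)) = W / 4" using pos by simp
  finally have "W / 4 \<le> (v - card ?A) * (K * W / v)" by linarith
  then have "card ?A \<le> (1 - 1 / (4 * K)) * v"
    by (intro complement_bound[OF pos(1,2) K]) auto
  then show ?thesis unfolding W_def v_def .
qed

text \<open>
  The base case is direct: an independent set avoids all vertices of positive weight, and there are at
  least \<open>card V / K\<close> of them.  The constant \<open>\<kappa>\<close> is multiplied by \<open>2 ^ (k+1) + 4\<close> in the step from
  \<open>k\<close> to \<open>k+1\<close>, because the auxiliary weight \<open>g\<close> satisfies the spread condition with \<open>K\<close> replaced by
  \<open>K * (2 ^ (k+1) + 4)\<close>.  In particular the shrinking rate depends linearly on \<open>K\<close>, so that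
  polylogarithmic \<open>K\<close> still gives polylogarithmically many rounds.
\<close>

lemma container_lemma:
  assumes "k \<ge> 1"
  shows "\<exists>\<kappa>\<ge>1. \<forall>(V :: 'a set) b K w.
           finite V \<longrightarrow> V \<noteq> {} \<longrightarrow> b \<ge> 1 \<longrightarrow> K > 0 \<longrightarrow>
           uniform_weight V k w \<longrightarrow> wdeg V w {} > 0 \<longrightarrow> spread V b K w \<longrightarrow>
           containers (edge_free w) ((card V + 1) ^ (b * (k - 1)))
             (\<lambda>C. card C \<le> (1 - 1 / (\<kappa> * K)) * card V) V"
  using assms
proof (induction k rule: nat_induct_at_least)
  case base
  show ?case
  proof (intro exI[of _ 1] conjI allI impI)
    fix V :: "'a set" and b :: nat and K :: real and w
    assume V: "finite V" "V \<noteq> {}" and K: "K > 0"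
      and w: "uniform_weight V 1 w" "wdeg V w {} > 0" "spread V b K w"
    define W v where "W = wdeg V w {}" and "v = real (card V)"
    have pos: "W > 0" "v > 0" using V w(2) by (auto simp: W_def v_def card_gt_0_iff)
    let ?A = "{x\<in>V. w {x} = 0}"
    have "W = (\<Sum>e | e \<subseteq> V. w e)" by (simp add: W_def wdeg_def)
    also have "\<dots> = (\<Sum>e\<in>(\<lambda>x. {x}) ` (V - ?A). w e)"
    proof (rule sum.mono_neutral_right)
      show "\<forall>i\<in>{e. e \<subseteq> V} - (\<lambda>x. {x}) ` (V - ?A). w i = 0"
      proof
        fix e assume e: "e \<in> {e. e \<subseteq> V} - (\<lambda>x. {x}) ` (V - ?A)"
        show "w e = 0"
        proof (rule ccontr)
          assume "w e \<noteq> 0"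
          then have "card e = 1" using w(1) by (auto simp: uniform_weight_def)
          then obtain x where "e = {x}" by (auto simp: card_1_singleton_iff)
          then show False using e \<open>w e \<noteq> 0\<close> by auto
        qed
      qed
    qed (use V in auto)
    also have "\<dots> = (\<Sum>x\<in>V - ?A. w {x})" by (subst sum.reindex) auto
    also have "\<dots> \<le> card (V - ?A) * (K * W / v)"
    proof (rule sum_bounded_above)
      fix x assume x: "x \<in> V - ?A"
      have "w {x} \<le> wdeg V w {x}"
        unfolding wdeg_def by (rule member_le_sum) (use x V w(1) in \<open>auto simp: uniform_weight_def\<close>)
      also have "\<dots> \<le> K * W / v"
        using w(3) x unfolding spread_def W_def v_def by (auto dest!: spec[of _ "{x}"])
      finally show "w {x} \<le> K * W / v" .
    qed
    also have "real (card (V - ?A)) = v - card ?A"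
      using V(1) by (subst card_Diff_subset) (auto simp: v_def of_nat_diff card_mono)
    finally have "card ?A \<le> (1 - 1 / (1 * K)) * v"
      by (intro complement_bound[OF pos K]) auto
    then show "containers (edge_free w) ((card V + 1) ^ (b * (1 - 1)))
             (\<lambda>C. card C \<le> (1 - 1 / (1 * K)) * card V) V"
      by (intro containers_single[of ?A]) (auto simp: v_def edge_free_def)
  qed auto
next
  case (Suc k)
  then obtain \<kappa> :: real where \<kappa>: "\<kappa> \<ge> 1"
    and IH: "\<And>(V :: 'a set) b K w. finite V \<Longrightarrow> V \<noteq> {} \<Longrightarrow> b \<ge> 1 \<Longrightarrow> K > 0 \<Longrightarrow>
           uniform_weight V k w \<Longrightarrow> wdeg V w {} > 0 \<Longrightarrow> spread V b K w \<Longrightarrow>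
           containers (edge_free w) ((card V + 1) ^ (b * (k - 1)))
             (\<lambda>C. card C \<le> (1 - 1 / (\<kappa> * K)) * card V) V"
    by blast
  define \<kappa>' :: real where "\<kappa>' = \<kappa> * (2 ^ Suc k + 4)"
  have "1 * (0 + 4) \<le> \<kappa> * (2 ^ Suc k + 4)" using \<kappa> by (intro mult_mono add_mono) auto
  then have \<kappa>': "\<kappa>' \<ge> 4" unfolding \<kappa>'_def by simp
  show ?case
  proof (intro exI[of _ \<kappa>'] conjI allI impI)
    fix V :: "'a set" and b :: nat and K :: real and w
    assume V: "finite V" "V \<noteq> {}" and b: "b \<ge> 1" and K: "K > 0"
      and w: "uniform_weight V (Suc k) w" "wdeg V w {} > 0" "spread V b K w"
    define W v q where "W = wdeg V w {}" and "v = real (card V)" and "q = real b / card V"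
    have pos: "W > 0" "v > 0" "q > 0" using V b w(2) by (auto simp: W_def v_def q_def card_gt_0_iff)
    define c where "c = K * W / v"
    have c: "c > 0" using pos K by (simp add: c_def)
    let ?c = "2 ^ Suc k / 4 * c"
    have spread: "wdeg V w T \<le> c * q ^ (card T - 1)" if "T \<subseteq> V" "T \<noteq> {}" for T
      using w(3) that unfolding spread_def W_def v_def q_def c_def by auto
    define P where "P = (\<lambda>C :: 'a set. card C \<le> (1 - 1 / (\<kappa>' * K)) * card V)"
    let ?B = "(card V + 1) ^ (b * (k - 1))"
    \<comment> \<open>The bound on the degrees of \<open>g\<close> is the saturation threshold plus one link, since a set
      receives no further weight once it is saturated.\<close>
    have heavy: "containers (edge_free w \<inter> edge_free g) ?B P V"
      if g: "uniform_weight V k g"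
        and cap: "\<And>T. T \<subseteq> V \<Longrightarrow> T \<noteq> {} \<Longrightarrow> wdeg V g T \<le> (?c + c) * q ^ card T"
        and heavy: "q * W / 4 \<le> wdeg V g {}" for g
    proof -
      let ?K = "K * (2 ^ Suc k + 4)"
      have "wdeg V g T \<le> ?K * wdeg V g {} / v * q ^ (card T - 1)" if T: "T \<subseteq> V" "T \<noteq> {}" for T
      proof -
        have "card T > 0" using T V(1) finite_subset by (auto simp: card_gt_0_iff)
        then have "(?c + c) * q ^ card T = ?K * (q * W / 4) / v * q ^ (card T - 1)"
          using pos by (cases "card T") (auto simp: c_def field_simps)
        also have "\<dots> \<le> ?K * wdeg V g {} / v * q ^ (card T - 1)"
          using heavy pos K by (intro mult_right_mono divide_right_mono mult_left_mono) auto
        finally show ?thesis using cap[OF T] by linarith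
      qed
      then have "spread V b ?K g" by (auto simp: spread_def v_def q_def)
      moreover have "?K > 0" using K by (simp add: add_pos_pos)
      moreover have "0 < q * W / 4" using pos by simp
      then have "wdeg V g {} > 0" using heavy by linarith
      ultimately have "containers (edge_free g) ?B (\<lambda>C. card C \<le> (1 - 1 / (\<kappa> * ?K)) * card V) V"
        using V b g by (intro IH) auto
      moreover have "\<kappa> * ?K = \<kappa>' * K" by (simp add: \<kappa>'_def)
      ultimately have "containers (edge_free g) ?B P V" by (simp only: P_def)
      then show ?thesis by (rule containers_mono[OF _ Int_lower2 order.refl])
    qed
    \<comment> \<open>With \<open>j\<close> links still to be added, \<open>g\<close> can become heavy: every link has weight at least
      \<open>W / (4 * v)\<close>, and \<open>b\<close> of them weigh \<open>q * W / 4\<close>.\<close>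
    have steps: "containers (edge_free w \<inter> edge_free g) ((card V + 1) ^ j * ?B) P V"
      if "uniform_weight V k g"
        and "\<And>T. T \<subseteq> V \<Longrightarrow> T \<noteq> {} \<Longrightarrow> wdeg V g T \<le> (?c + c) * q ^ card T"
        and "q * W / 4 \<le> wdeg V g {} + j * (W / (4 * v))" for j g
      using that
    proof (induction j arbitrary: g)
      case 0
      then show ?case using heavy[of g] by simp
    next
      case (Suc j)
      show ?case
      proof (cases "q * W / 4 \<le> wdeg V g {}")
        case True
        have "1 * ?B \<le> (card V + 1) ^ Suc j * ?B" by (intro mult_right_mono one_le_power) auto
        then show ?thesis
          using containers_mono[OF heavy[OF Suc.prems(1,2) True] order.refl, of _ P] by simp
      next
        case False
        define \<S> where "\<S> = saturated V ?c q g"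
        define A where "A = {x\<in>V. wdeg V (link V \<S> w x) {} < W / (4 * v)}"
        let ?g = "\<lambda>x f. g f + link V \<S> w x f"
        have "card A \<le> (1 - 1 / (4 * K)) * card V"
          unfolding A_def W_def v_def
        proof (rule few_light_links[OF V b K w Suc.prems(1)])
          show "wdeg V g {} < real b / card V * wdeg V w {} / 4"
            using False by (simp add: q_def W_def)
          show "\<S> = saturated V (2 ^ Suc k / 4 * (K * wdeg V w {} / card V)) (real b / card V) g"
            by (simp add: \<S>_def c_def q_def W_def v_def)
        qed
        also have "\<dots> \<le> (1 - 1 / (\<kappa>' * K)) * card V"
          using \<kappa>' K by (intro mult_right_mono) (auto simp: field_simps)
        finally have A: "A \<subseteq> V" "P A" by (auto simp: A_def P_def)
        \<comment> \<open>Either \<open>I\<close> lies in \<open>A\<close>, which is then its container, or the link of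
          some \<open>x\<close> in \<open>I - A\<close> is added.  The vertex \<open>x\<close> stays available and its link may be
          added again, so that the final container also covers the vertices of \<open>I\<close> used before.\<close>
        let ?X = "insert None (Some ` (V - A))"
        let ?J = "\<lambda>y. case y of None \<Rightarrow> {I. I \<subseteq> A} | Some x \<Rightarrow> edge_free w \<inter> edge_free (?g x)"
        have "containers (edge_free w \<inter> edge_free g) (card ?X * ((card V + 1) ^ j * ?B)) P V"
        proof (rule containers_branch[where \<J> = ?J and U = "\<lambda>_. V"])
          show "finite ?X" using V by simp
        next
          fix y assume "y \<in> ?X"
          show "containers (?J y) ((card V + 1) ^ j * ?B) P V"
          proof (cases y)
            case None
            have "(card V + 1) ^ j * ?B \<ge> 1"
              using one_le_power[of "card V + 1"] by (simp del: power_Suc)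
            then show ?thesis using A None by (intro containers_single[of A]) auto
          next
            case (Some x)
            with \<open>y \<in> ?X\<close> have x: "x \<in> V" "x \<notin> A" by auto
            have "containers (edge_free w \<inter> edge_free (?g x)) ((card V + 1) ^ j * ?B) P V"
            proof (rule Suc.IH)
              show "uniform_weight V k (?g x)"
                using Suc.prems(1) uniform_weight_link[OF V(1) x(1) w(1)] by (rule uniform_weight_add)
            next
              fix T assume T: "T \<subseteq> V" "T \<noteq> {}"
              have cq: "0 \<le> c * q ^ card T" using c pos by simp
              show "wdeg V (?g x) T \<le> (?c + c) * q ^ card T"
              proof (cases "T \<in> \<S>")
                case True
                then show ?thesis using Suc.prems(2)[OF T] by (simp add: wdeg_add wdeg_link_saturated)
              next
                case False
                have "wdeg V (link V \<S> w x) T \<le> c * q ^ card T"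
                proof (cases "x \<in> T")
                  case True
                  then show ?thesis using cq by (simp add: wdeg_link_mem)
                next
                  case False
                  moreover have "finite T" using T V finite_subset by blast
                  ultimately have "wdeg V w (insert x T) \<le> c * q ^ card T"
                    using spread[of "insert x T"] T x by simp
                  then show ?thesis using wdeg_link_le[OF V(1) x(1) w(1), of \<S> T] by linarith
                qed
                moreover have "wdeg V g T \<le> ?c * q ^ card T"
                  using False T by (auto simp: \<S>_def saturated_def)
                ultimately show ?thesis by (simp add: wdeg_add ring_distribs)
              qed
            next
              have "W / (4 * v) \<le> wdeg V (link V \<S> w x) {}" using x by (auto simp: A_def)
              then show "q * W / 4 \<le> wdeg V (?g x) {} + j * (W / (4 * v))"
                using Suc.prems(3) unfolding wdeg_add of_nat_Suc distrib_right by linarith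
            qed
            then show ?thesis using Some by simp
          qed
        next
          fix I assume I: "I \<in> edge_free w \<inter> edge_free g" "I \<subseteq> V"
          show "\<exists>y\<in>?X. I \<in> ?J y \<and> I \<subseteq> V"
          proof (cases "I \<subseteq> A")
            case True
            then show ?thesis using I by auto
          next
            case False
            then obtain x where x: "x \<in> I" "x \<notin> A" by blast
            have "I \<in> edge_free (?g x)"
              unfolding edge_free_def
            proof (intro CollectI allI impI notI)
              fix f assume f: "?g x f \<noteq> 0" "f \<subseteq> I"
              then have "g f = 0" using I by (auto simp: edge_free_def)
              then have "w (insert x f) \<noteq> 0" using f(1) by (auto simp: link_def split: if_splits)
              then show False using I x(1) f(2) by (auto simp: edge_free_def)
            qed
            then show ?thesis using I x by (intro bexI[of _ "Some x"]) auto
          qed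
        qed auto
        moreover
        have "card ?X \<le> card V + 1"
        proof -
          have "card ?X = Suc (card (V - A))" using V by (simp add: card_image)
          also have "card (V - A) \<le> card V" using V by (intro card_mono) auto
          finally show ?thesis by simp
        qed
        then have "card ?X * ((card V + 1) ^ j * ?B) \<le> (card V + 1) ^ Suc j * ?B"
          by (simp only: power_Suc mult.assoc) (rule mult_right_mono, auto)
        ultimately show ?thesis
          by (rule containers_mono[OF _ order.refl])
      qed
    qed
    have "containers (edge_free w \<inter> edge_free (\<lambda>_. 0)) ((card V + 1) ^ b * ?B) P V"
    proof (rule steps)
      show "uniform_weight V k (\<lambda>_. 0)" by (simp add: uniform_weight_def)
      show "wdeg V (\<lambda>_. 0) T \<le> (?c + c) * q ^ card T" for T
        using c pos by (simp add: wdeg_def)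
      show "q * W / 4 \<le> wdeg V (\<lambda>_. 0) {} + b * (W / (4 * v))"
        by (simp add: wdeg_def q_def v_def)
    qed
    moreover have "(card V + 1) ^ b * ?B = (card V + 1) ^ (b * (Suc k - 1))"
      using \<open>k \<ge> 1\<close> by (cases k) (auto simp: power_add)
    ultimately show "containers (edge_free w) ((card V + 1) ^ (b * (Suc k - 1)))
             (\<lambda>C. card C \<le> (1 - 1 / (\<kappa>' * K)) * card V) V"
      by (simp add: edge_free_def P_def)
  qed (use \<kappa>' in auto)
qed

section \<open>Copies and \<open>F\<close>-free subgraphs\<close>

lemma copies_subset: "e \<in> copies F H \<Longrightarrow> e \<subseteq> edges H"
  by (auto simp: copies_def subgraph_def)

lemma copies_mono:
  assumes "A \<subseteq> A'"
  shows "copies F (V, A) \<subseteq> copies F (V, A')"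
proof
  fix e assume "e \<in> copies F (V, A)"
  then obtain G where G: "e = edges G" "subgraph G (V, A)" "isomorphic F G"
    unfolding copies_def by blast
  moreover have "subgraph G (V, A')" using G(2) assms by (auto simp: subgraph_def)
  ultimately show "e \<in> copies F (V, A')" unfolding copies_def by blast
qed

lemma card_copy:
  assumes "rgraph r F" "e \<in> copies F H"
  shows "card e = card (edges F)"
proof -
  obtain G \<phi> where G: "e = edges G" "bij_betw \<phi> (verts F) (verts G)" "edges G = (\<lambda>e. \<phi> ` e) ` edges F"
    using assms(2) by (auto simp: copies_def isomorphic_def)
  have "inj_on (\<lambda>e. \<phi> ` e) (Pow (verts F))"
    using G(2) by (intro inj_on_image_Pow) (auto simp: bij_betw_def)
  moreover have "edges F \<subseteq> Pow (verts F)" using assms(1) by (auto simp: rgraph_def nsets_def)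
  ultimately have "inj_on (\<lambda>e. \<phi> ` e) (edges F)" by (rule inj_on_subset)
  then show ?thesis using G by (simp add: card_image)
qed

text \<open>
  A copy is recorded by its edge set only, so a graph containing these edges need not have
  enough vertices to accommodate the isolated vertices of \<open>F\<close>.  If it has at least as many vertices
  as \<open>F\<close>, then the non-isolated vertices can stay where they are, and the isolated ones are placed
  arbitrarily.
\<close>

lemma copies_nonempty_transfer:
  assumes F: "rgraph r F" and e: "e \<in> copies F H"
    and G: "finite (verts G)" "edges G \<subseteq> Pow (verts G)" "e \<subseteq> edges G"
    and card: "card (verts F) \<le> card (verts G)"
  shows "copies F G \<noteq> {}"
proof -
  obtain X \<phi> where X: "e = edges X" "bij_betw \<phi> (verts F) (verts X)" "edges X = (\<lambda>e. \<phi> ` e) ` edges F"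
    using e by (auto simp: copies_def isomorphic_def)
  define U where "U = \<Union>(edges F)"
  have U: "U \<subseteq> verts F" using F by (auto simp: rgraph_def nsets_def U_def)
  have finF: "finite (verts F)" using F by (auto simp: rgraph_def)
  have \<phi>U: "\<phi> ` U \<subseteq> verts G" 
  proof -
    have "\<phi> ` f \<subseteq> verts G" if "f \<in> edges F" for f
    proof -
      have "\<phi> ` f \<in> e" using X(1,3) that by simp
      then show ?thesis using G(2,3) by auto
    qed
    then show ?thesis unfolding U_def by auto
  qed
  have inj: "inj_on \<phi> U" using X(2) U by (auto simp: bij_betw_def intro: inj_on_subset)
  have "card (verts F - U) \<le> card (verts G - \<phi> ` U)"
    using card U \<phi>U finF G(1) inj
    by (subst (1 2) card_Diff_subset) (auto simp: card_image finite_subset)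
  then obtain h where h: "h ` (verts F - U) \<subseteq> verts G - \<phi> ` U" "inj_on h (verts F - U)"
    using card_le_inj[of "verts F - U" "verts G - \<phi> ` U"] finF G(1) by auto
  define \<psi> where "\<psi> x = (if x \<in> U then \<phi> x else h x)" for x
  have "inj_on \<psi> (U \<union> (verts F - U))"
    unfolding inj_on_Un
  proof (intro conjI)
    show "inj_on \<psi> U" using inj by (simp add: \<psi>_def inj_on_def)
    show "inj_on \<psi> (verts F - U)" using h(2) by (simp add: \<psi>_def inj_on_def)
    show "\<psi> ` (U - (verts F - U)) \<inter> \<psi> ` (verts F - U - U) = {}"
      using h(1) by (auto simp: \<psi>_def)
  qed
  then have inj\<psi>: "inj_on \<psi> (verts F)" using U by (simp add: Un_absorb1)
  have im: "\<psi> ` verts F \<subseteq> verts G" using h(1) \<phi>U by (auto simp: \<psi>_def)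
  have edge: "\<psi> ` f = \<phi> ` f" if "f \<in> edges F" for f
    using that by (intro image_cong) (auto simp: \<psi>_def U_def)
  then have eq: "e = (\<lambda>f. \<psi> ` f) ` edges F" using X by auto
  have "subgraph (\<psi> ` verts F, e) G"
  proof -
    have "f \<subseteq> verts F" if "f \<in> edges F" for f
      using F that by (auto simp: rgraph_def nsets_def)
    then have "e \<subseteq> Pow (\<psi> ` verts F)" unfolding eq by (auto intro: image_mono)
    then show ?thesis using im G(3) by (simp add: subgraph_def)
  qed
  moreover have "isomorphic F (\<psi> ` verts F, e)"
    unfolding isomorphic_def using inj\<psi> eq by (auto simp: bij_betw_def)
  ultimately have "e \<in> copies F G" unfolding copies_def by (intro CollectI exI[of _ "(\<psi> ` verts F, e)"]) auto
  then show ?thesis by blast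
qed

lemma ex_gtE:
  fixes G :: "'b hypergraph" and F :: "'a hypergraph"
  assumes "finite (verts G)" "edges F \<noteq> {}" "s < real (ex G F)"
  obtains G' where "subgraph G' G" "copies F G' = {}" "s < card (edges G')"
proof -
  let ?S = "{card (edges G') | G'. subgraph G' G \<and> copies F G' = {}}"
  let ?\<G> = "{G'. subgraph G' G}"
  have "?\<G> \<subseteq> Pow (verts G) \<times> Pow (Pow (verts G))" by (auto simp: subgraph_def) blast
  then have "finite ?\<G>" by (rule finite_subset) (use assms(1) in simp)
  moreover have "?S \<subseteq> (\<lambda>G'. card (edges G')) ` ?\<G>" by blast
  ultimately have fin: "finite ?S" by (rule finite_surj)
  have "subgraph ({}, {}) G" by (auto simp: subgraph_def)
  moreover have "copies F ({}, {} :: 'b set set) = {}"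
    using assms(2) by (auto simp: copies_def subgraph_def isomorphic_def)
  ultimately have "0 \<in> ?S" by (intro CollectI exI[of _ "({}, {} :: 'b set set)"]) simp
  then have "ex G F \<in> ?S" unfolding ex_def using fin by (intro Max_in) auto
  then show thesis using that assms(3) by auto
qed

section \<open>Random subsets and numerical estimates\<close>

text \<open>
  Chernoff's method with the exponential moment of parameter \<open>1\<close>; the expectation factorizes, and each factor is
  \<open>1 + (exp 1 - 1) * p \<le> exp (2 * p)\<close>.
\<close>

lemma prob_binomial_upper_tail:
  assumes A: "finite A" "C \<subseteq> A" and p: "0 \<le> p" "p \<le> 1"
  shows "measure_pmf.prob (Pi_pmf A False (\<lambda>_. bernoulli_pmf p)) {X. s \<le> real (card {e\<in>C. X e})}
          \<le> exp (2 * p * card C - s)"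
proof -
  let ?M = "Pi_pmf A False (\<lambda>_. bernoulli_pmf p)"
  define f :: "'a \<Rightarrow> bool \<Rightarrow> real" where "f = (\<lambda>e x. if e \<in> C \<and> x then exp 1 else 1)"
  define u where "u X = exp (real (card {e\<in>C. X e}))" for X
  have finC: "finite C" using A finite_subset by blast
  have u: "u = (\<lambda>X. \<Prod>e\<in>A. f e (X e))"
  proof
    fix X
    have "(\<Prod>e\<in>A. f e (X e)) = (\<Prod>e\<in>{e\<in>A. e \<in> C \<and> X e}. exp 1)"
      unfolding f_def by (rule prod.inter_filter[OF A(1), symmetric])
    also have "{e\<in>A. e \<in> C \<and> X e} = {e\<in>C. X e}" using A by auto
    also have "(\<Prod>e\<in>{e\<in>C. X e}. exp (1::real)) = u X"
      by (simp add: u_def exp_of_nat_mult[symmetric])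
    finally show "u X = (\<Prod>e\<in>A. f e (X e))" ..
  qed
  have "integrable ?M u"
    unfolding u using A(1) by (intro integrable_prod_Pi_pmf integrable_measure_pmf_finite) auto
  then have "measure ?M {X\<in>space ?M. exp s \<le> u X} \<le> measure_pmf.expectation ?M u / exp s"
    by (rule integral_Markov_inequality_measure[where A = "{}"]) (auto simp: u_def)
  also have "{X\<in>space ?M. exp s \<le> u X} = {X. s \<le> real (card {e\<in>C. X e})}"
    by (simp add: u_def)
  also have "measure_pmf.expectation ?M u
      = (\<Prod>e\<in>A. measure_pmf.expectation (bernoulli_pmf p) (f e))"
    unfolding u by (rule expectation_prod_Pi_pmf) (use A in \<open>auto intro: integrable_measure_pmf_finite simp: f_def\<close>)
  also have "\<dots> = (\<Prod>e\<in>A. if e \<in> C then exp 1 * p + (1 - p) else 1)"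
    using p by (intro prod.cong) (auto simp: f_def)
  also have "\<dots> = (\<Prod>e\<in>{e\<in>A. e \<in> C}. exp 1 * p + (1 - p))"
    by (rule prod.inter_filter[OF A(1), symmetric])
  also have "{e\<in>A. e \<in> C} = C" using A by auto
  also have "(\<Prod>e\<in>C. exp 1 * p + (1 - p)) \<le> (\<Prod>e\<in>C. exp (2 * p))"
  proof (intro prod_mono conjI)
    have "exp 1 \<le> (3::real)" using exp_le by simp
    then have "exp 1 * p \<le> 3 * p" using p by (intro mult_right_mono) auto
    then have "exp 1 * p + (1 - p) \<le> 1 + 2 * p" by simp
    also have "\<dots> \<le> exp (2 * p)" by (rule exp_ge_add_one_self)
    finally show "exp 1 * p + (1 - p) \<le> exp (2 * p)" .
    show "0 \<le> exp 1 * p + (1 - p)" using p by (intro add_nonneg_nonneg mult_nonneg_nonneg) auto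
  qed
  also have "\<dots> = exp (2 * p * card C)" by (simp add: exp_of_nat_mult[symmetric] mult_ac)
  finally show ?thesis by (simp add: exp_diff divide_right_mono)
qed

text \<open>
  With \<open>L = ln n\<close> and \<open>\<gamma> = L powr C\<close>, about \<open>t = \<kappa> * \<gamma> * r * L\<close> rounds suffice to exhaust the at most
  \<open>n ^ r = exp (r * L)\<close> potential edges.  The second quantity is the logarithm
  of the number of containers after \<open>t\<close> rounds; it is of order \<open>\<tau> * L powr (C + 2)\<close>, so any exponent
  beyond \<open>C + 2\<close> would absorb the constants.  The value \<open>C + 8\<close> makes the same number usable
  as the factor of \<open>p * m\<close>, where the union bound needs at least \<open>8\<close>.
\<close>

lemma container_numerics:
  fixes C \<kappa> :: real and r k :: nat
  assumes "C > 0" "\<kappa> \<ge> 1" "r \<ge> 1"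
  shows "\<forall>\<^sub>F n in sequentially. \<exists>t :: nat.
           (1 - 1 / (\<kappa> * ln (real n) powr C)) ^ t * real (n choose r) < 1 \<and>
           (\<forall>\<tau>\<ge>1. t * (nat \<lceil>\<tau>\<rceil> * k) * ln (real (n choose r) + 1) \<le> \<tau> * ln (real n) powr (C + 8) / 4)"
proof -
  define A where "A = 2 * (\<kappa> * r + 2) * k * (r + 1)"
  have "\<forall>\<^sub>F n in sequentially. ln (real n) \<ge> max 1 (4 * A)"
    using filterlim_compose[OF ln_at_top filterlim_real_sequentially]
    unfolding filterlim_at_top by blast
  then show ?thesis
    using eventually_ge_at_top[of 2]
  proof eventually_elim
    case (elim n)
    define L \<gamma> N where "L = ln (real n)" and "\<gamma> = L powr C" and "N = real (n choose r)"
    have n: "n \<ge> 2" and L: "L \<ge> 1" "L \<ge> 4 * A" using elim by (auto simp: L_def)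
    have \<gamma>: "\<gamma> \<ge> 1" using L assms(1) by (simp add: \<gamma>_def ge_one_powr_ge_zero)
    have \<kappa>\<gamma>: "\<kappa> * \<gamma> \<ge> 1" using \<gamma> assms(2) mult_mono[of 1 \<kappa> 1 \<gamma>] by simp
    have N: "N \<le> real n ^ r"
    proof (cases "r \<le> n")
      case True
      then show ?thesis unfolding N_def using binomial_le_pow[of r n] by (metis of_nat_le_iff of_nat_power)
    qed (simp add: N_def binomial_eq_0)
    have nr: "real n ^ r = exp (r * L)" using n by (simp add: L_def exp_of_nat_mult)
    have "N + 1 \<le> real n ^ r + real n ^ r" using N n by (intro add_mono) auto
    also have "\<dots> \<le> real n ^ (r + 1)" using n by simp
    also have "\<dots> = exp ((r + 1) * L)" using n by (simp add: L_def exp_of_nat_mult[symmetric] nr distrib_right exp_add)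
    finally have "N + 1 \<le> exp ((r + 1) * L)" .
    moreover have "N \<ge> 0" by (simp add: N_def)
    ultimately have lnN: "ln (N + 1) \<le> (r + 1) * L" "ln (N + 1) \<ge> 0"
      using ln_le_cancel_iff[of "N + 1" "exp ((r + 1) * L)"] by auto
    define t where "t = nat \<lceil>\<kappa> * \<gamma> * r * L\<rceil> + 1"
    have pos: "0 \<le> \<kappa> * \<gamma> * r * L" using L \<kappa>\<gamma> by auto
    have t: "\<kappa> * \<gamma> * r * L < t" "t \<le> \<kappa> * \<gamma> * r * L + 2"
      unfolding t_def using pos by linarith+
    have "(1 - 1 / (\<kappa> * \<gamma>)) ^ t \<le> exp (- (1 / (\<kappa> * \<gamma>))) ^ t"
      using exp_ge_add_one_self[of "- (1 / (\<kappa> * \<gamma>))"] \<kappa>\<gamma> by (intro power_mono) auto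
    also have "\<dots> = exp (- (t / (\<kappa> * \<gamma>)))" by (simp add: exp_of_nat_mult[symmetric])
    also have "\<dots> < exp (- (r * L))"
      using t(1) \<kappa>\<gamma> by (simp add: field_simps)
    finally have small: "(1 - 1 / (\<kappa> * \<gamma>)) ^ t < exp (- (r * L))" .
    have "(1 - 1 / (\<kappa> * \<gamma>)) ^ t * N < 1"
    proof (cases "N = 0")
      case False
      then have "N > 0" using \<open>N \<ge> 0\<close> by simp
      then have "(1 - 1 / (\<kappa> * \<gamma>)) ^ t * N < exp (- (r * L)) * N"
        using small by (rule mult_strict_right_mono[rotated])
      also have "\<dots> \<le> exp (- (r * L)) * exp (r * L)"
        using N nr by (intro mult_left_mono) auto
      finally show ?thesis by (simp add: exp_minus)
    qed simp
    moreover have "t * (nat \<lceil>\<tau>\<rceil> * k) * ln (N + 1) \<le> \<tau> * L powr (C + 8) / 4" if \<tau>: "\<tau> \<ge> 1" for \<tau>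
    proof -
      define b where "b = nat \<lceil>\<tau>\<rceil>"
      have b: "b \<le> 2 * \<tau>" using \<tau> unfolding b_def by linarith
      have "1 \<le> \<gamma> * L" using mult_mono[of 1 \<gamma> 1 L] \<gamma> L by simp
      then have "t \<le> (\<kappa> * r + 2) * (\<gamma> * L)" using t(2) by (simp add: algebra_simps)
      then have "t * (b * k) * ln (N + 1)
          \<le> ((\<kappa> * r + 2) * (\<gamma> * L)) * (2 * \<tau> * k) * ((r + 1) * L)"
        using b lnN L \<gamma> \<tau> assms(2) unfolding of_nat_mult by (intro mult_mono) auto
      also have "\<dots> = \<tau> * (L powr C * L * (L * A))" by (simp add: A_def \<gamma>_def mult_ac)
      also have "\<dots> \<le> \<tau> * (L powr (C + 8) / 4)"
      proof -
        have "L powr C * L * (L * A) \<le> L powr C * L * (L * (L / 4))"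
          using L by (intro mult_left_mono) auto
        also have "\<dots> = L powr (C + 3) / 4"
          using L by (simp add: powr_add powr_numeral power3_eq_cube)
        also have "\<dots> \<le> L powr (C + 8) / 4" using L by (intro divide_right_mono powr_mono) auto
        finally show ?thesis using \<tau> by (intro mult_left_mono) auto
      qed
      finally show ?thesis by (simp add: b_def)
    qed
    ultimately show ?case unfolding L_def \<gamma>_def N_def by (intro exI[of _ t]) auto
  qed
qed

section \<open>Containers for \<open>F\<close>-free edge sets\<close>

text \<open>
  The container lemma is applied to the indicator function of \<open>\<C>\<close>, where weighted degrees are the
  degrees of the hypergraph \<open>\<C>\<close> on the vertex set \<open>edges H\<close>.
\<close>

lemma containers_of_balanced_collection:
  fixes H :: "nat hypergraph" and \<gamma> \<tau> :: real
  assumes F: "rgraph r F"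
    and H: "finite (edges H)" "edges H \<noteq> {}"
    and \<C>: "\<C> \<subseteq> copies F H" "\<C> \<noteq> {}"
    and deg: "\<And>i. i \<in> {1..card (edges F)} \<Longrightarrow>
           real (max_deg (edges H, \<C>) i)
             \<le> \<gamma> * real (card \<C>) / real (card (edges H)) * (\<tau> / real (card (edges H))) ^ (i - 1)"
    and b: "b \<ge> 1" "0 < \<tau>" "\<tau> \<le> real b" and "\<gamma> > 0"
    and container: "\<And>(V :: nat set set) b K w.
           finite V \<Longrightarrow> V \<noteq> {} \<Longrightarrow> b \<ge> 1 \<Longrightarrow> K > 0 \<Longrightarrow>
           uniform_weight V (card (edges F)) w \<Longrightarrow> wdeg V w {} > 0 \<Longrightarrow> spread V b K w \<Longrightarrow>
           containers (edge_free w) ((card V + 1) ^ (b * (card (edges F) - 1)))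
             (\<lambda>C. card C \<le> (1 - 1 / (\<kappa> * K)) * card V) V"
  shows "containers {I. \<forall>e\<in>copies F H. \<not> e \<subseteq> I}
           ((card (edges H) + 1) ^ (b * (card (edges F) - 1)))
           (\<lambda>C. card C \<le> (1 - 1 / (\<kappa> * \<gamma>)) * card (edges H)) (edges H)"
proof -
  define V k w where "V = edges H" and "k = card (edges F)"
    and "w = (\<lambda>e. if e \<in> \<C> then 1 else 0 :: real)"
  have V: "finite V" "V \<noteq> {}" using H by (auto simp: V_def)
  have sub: "e \<subseteq> V" "card e = k" if "e \<in> \<C>" for e
    using that \<C>(1) card_copy[OF F, of e H] copies_subset[of e F H] by (auto simp: V_def k_def)
  have fin\<C>: "finite \<C>"
    by (rule finite_subset[of _ "Pow V"]) (use sub(1) V in auto)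
  have wdeg: "wdeg V w T = card {e\<in>\<C>. T \<subseteq> e}" for T
  proof -
    have "wdeg V w T = (\<Sum>e | e \<in> {e. e \<subseteq> V \<and> T \<subseteq> e} \<and> e \<in> \<C>. 1)"
      unfolding wdeg_def w_def
      by (rule sum.inter_filter[symmetric]) (use V in auto)
    also have "{e. e \<in> {e. e \<subseteq> V \<and> T \<subseteq> e} \<and> e \<in> \<C>} = {e\<in>\<C>. T \<subseteq> e}" using sub(1) by auto
    finally show ?thesis by simp
  qed
  have total: "wdeg V w {} = card \<C>" by (simp add: wdeg)
  have pos: "0 < wdeg V w {}" using fin\<C> \<C>(2) by (simp add: total card_gt_0_iff)
  have v: "card V > 0" using V by (simp add: card_gt_0_iff)
  have "spread V b \<gamma> w"
    unfolding spread_def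
  proof (intro allI impI)
    fix T assume T: "T \<subseteq> V" "T \<noteq> {}"
    have finT: "finite T" using T V finite_subset by blast
    show "wdeg V w T \<le> \<gamma> * wdeg V w {} / card V * (real b / card V) ^ (card T - 1)"
    proof (cases "{e\<in>\<C>. T \<subseteq> e} = {}")
      case True
      then have "wdeg V w T = 0" by (simp only: wdeg card.empty of_nat_0)
      moreover have "0 \<le> \<gamma> * wdeg V w {} / card V * (real b / card V) ^ (card T - 1)"
        using pos \<open>\<gamma> > 0\<close> by (intro mult_nonneg_nonneg divide_nonneg_nonneg zero_le_power) auto
      ultimately show ?thesis by linarith
    next
      case False
      then obtain e where e: "e \<in> \<C>" "T \<subseteq> e" by blast
      have "card T \<le> k" using card_mono[OF _ e(2)] sub[OF e(1)] V finite_subset by metis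
      moreover have "card T \<ge> 1" using T finT by (simp add: Suc_le_eq card_gt_0_iff)
      ultimately have i: "card T \<in> {1..card (edges F)}" by (simp add: k_def)
      have "deg (V, \<C>) T \<le> max_deg (V, \<C>) (card T)"
        unfolding max_deg_def using T finT V
        by (intro Max_ge finite_imageI imageI) (auto simp: finite_imp_finite_nsets nsets_def)
      then have "wdeg V w T \<le> max_deg (V, \<C>) (card T)" by (simp add: wdeg deg_def)
      also have "\<dots> \<le> \<gamma> * card \<C> / card V * (\<tau> / card V) ^ (card T - 1)"
        using deg[OF i] by (simp add: V_def)
      also have "\<dots> \<le> \<gamma> * card \<C> / card V * (real b / card V) ^ (card T - 1)"
        using b \<open>\<gamma> > 0\<close> by (intro mult_left_mono power_mono divide_right_mono) auto
      finally show ?thesis by (simp add: total)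
    qed
  qed
  moreover have "uniform_weight V k w" using sub by (auto simp: uniform_weight_def w_def)
  ultimately have "containers (edge_free w) ((card V + 1) ^ (b * (k - 1)))
             (\<lambda>C. card C \<le> (1 - 1 / (\<kappa> * \<gamma>)) * card V) V"
    using V b \<open>\<gamma> > 0\<close> pos unfolding k_def by (intro container) auto
  moreover have "{I. \<forall>e\<in>copies F H. \<not> e \<subseteq> I} \<subseteq> edge_free w"
    using \<C>(1) by (auto simp: edge_free_def w_def)
  ultimately show ?thesis
    unfolding V_def k_def by (rule containers_mono[OF _ _ order.refl])
qed

text \<open>
  The hypergraph of copies changes from round to round, but a copy of \<open>F\<close> in a subgraph on the same
  vertices is a copy in the complete graph.  Hence the class of independent sets can be
  fixed beforehand.
\<close>

lemma small_containers_of_balanced: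
  fixes F :: "'a hypergraph" and \<gamma> M :: real and \<tau> :: "nat \<Rightarrow> real"
  assumes F: "rgraph r F"
    and balanced: "\<And>H :: nat hypergraph. rgraph r H \<Longrightarrow> card (verts H) = n \<Longrightarrow>
        real (card (edges H)) \<ge> M \<Longrightarrow>
        \<exists>\<C>. \<C> \<subseteq> copies F H \<and> \<C> \<noteq> {} \<and>
          (\<forall>i\<in>{1..card (edges F)}.
             real (max_deg (edges H, \<C>) i)
               \<le> \<gamma> * real (card \<C>) / real (card (edges H))
                   * (\<tau> (card (edges H)) / real (card (edges H))) ^ (i - 1))"
    and m: "M \<le> real m" "m \<ge> 1"
    and b: "b \<ge> 1" "\<And>m'. m' \<ge> m \<Longrightarrow> 0 < \<tau> m' \<and> \<tau> m' \<le> real b"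
    and \<gamma>: "\<gamma> \<ge> 1" and \<kappa>: "\<kappa> \<ge> 1"
    and container: "\<And>(V :: nat set set) b K w.
           finite V \<Longrightarrow> V \<noteq> {} \<Longrightarrow> b \<ge> 1 \<Longrightarrow> K > 0 \<Longrightarrow>
           uniform_weight V (card (edges F)) w \<Longrightarrow> wdeg V w {} > 0 \<Longrightarrow> spread V b K w \<Longrightarrow>
           containers (edge_free w) ((card V + 1) ^ (b * (card (edges F) - 1)))
             (\<lambda>C. card C \<le> (1 - 1 / (\<kappa> * K)) * card V) V"
    and t: "(1 - 1 / (\<kappa> * \<gamma>)) ^ t * real (n choose r) < 1"
  shows "containers {I. \<forall>e\<in>copies F ({..<n}, [{..<n}]\<^bsup>r\<^esup>). \<not> e \<subseteq> I}
           ((((n choose r) + 1) ^ (b * (card (edges F) - 1))) ^ t)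
           (\<lambda>C. card C < m) ([{..<n}]\<^bsup>r\<^esup>)"
proof -
  let ?U = "[{..<n}]\<^bsup>r\<^esup>"
  let ?I = "{I. \<forall>e\<in>copies F ({..<n}, ?U). \<not> e \<subseteq> I}"
  define B where "B = ((n choose r) + 1) ^ (b * (card (edges F) - 1))"
  have U: "finite ?U" "card ?U = n choose r" by (auto simp: finite_imp_finite_nsets)
  have "1 \<le> \<kappa> * \<gamma>" using mult_mono[of 1 \<kappa> 1 \<gamma>] \<gamma> \<kappa> by simp
  have "containers ?I (B ^ t) (\<lambda>D. card D < m \<or> card D \<le> (1 - 1 / (\<kappa> * \<gamma>)) ^ t * card ?U) ?U"
  proof (rule containers_iterate[OF U(1) _ _ _ order.refl])
    show "1 \<le> B" unfolding B_def by (rule one_le_power) simp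
    show "1 / (\<kappa> * \<gamma>) \<le> 1" using \<open>1 \<le> \<kappa> * \<gamma>\<close> by simp
    fix C assume C: "C \<subseteq> ?U" "m \<le> card C"
    let ?H = "({..<n}, C)"
    have "rgraph r ?H" using C by (simp add: rgraph_def)
    moreover have "M \<le> real (card (edges ?H))" using C(2) m(1) by simp
    ultimately obtain \<C> where \<C>: "\<C> \<subseteq> copies F ?H" "\<C> \<noteq> {}"
        "\<forall>i\<in>{1..card (edges F)}.
             real (max_deg (edges ?H, \<C>) i)
               \<le> \<gamma> * real (card \<C>) / real (card (edges ?H))
                   * (\<tau> (card (edges ?H)) / real (card (edges ?H))) ^ (i - 1)"
      using balanced[of ?H] by (metis card_lessThan fst_conv)
    have "containers {I. \<forall>e\<in>copies F ?H. \<not> e \<subseteq> I}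
           ((card (edges ?H) + 1) ^ (b * (card (edges F) - 1)))
           (\<lambda>C. card C \<le> (1 - 1 / (\<kappa> * \<gamma>)) * card (edges ?H)) (edges ?H)"
    proof (rule containers_of_balanced_collection[OF F _ _ \<C>(1,2) _ b(1) _ _ _ container])
      show "finite (edges ?H)" using C(1) U(1) finite_subset by simp
      show "edges ?H \<noteq> {}" using C(2) m(2) by auto
      show "0 < \<tau> (card (edges ?H))" "\<tau> (card (edges ?H)) \<le> real b" using b(2) C(2) by auto
    qed (use \<C>(3) \<gamma> in auto)
    moreover have "?I \<subseteq> {I. \<forall>e\<in>copies F ?H. \<not> e \<subseteq> I}"
      using copies_mono[OF C(1), of F "{..<n}"] by blast
    moreover have "card C \<le> n choose r" using card_mono[OF U(1) C(1)] U(2) by simp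
    then have "(card (edges ?H) + 1) ^ (b * (card (edges F) - 1)) \<le> B"
      unfolding B_def by (intro power_mono) auto
    ultimately have "containers ?I B
        (\<lambda>C. card C \<le> (1 - 1 / (\<kappa> * \<gamma>)) * card (edges ?H)) (edges ?H)"
      by (rule containers_mono)
    then show "containers ?I B (\<lambda>D. card D \<le> (1 - 1 / (\<kappa> * \<gamma>)) * card C) C" by simp
  qed
  then show ?thesis
    unfolding B_def
  proof (rule containers_mono[OF _ order.refl order.refl])
    fix D assume "card D < m \<or> card D \<le> (1 - 1 / (\<kappa> * \<gamma>)) ^ t * card ?U"
    then show "card D < m"
    proof
      assume "card D \<le> (1 - 1 / (\<kappa> * \<gamma>)) ^ t * card ?U"
      with t U(2) have "card D < 1" by simp
      then show ?thesis using m(2) by simp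
    qed
  qed
qed

section \<open>The extremal number of the random graph\<close>

text \<open>
  If the random graph has an \<open>F\<close>-free subgraph with more than \<open>s\<close> edges, then some
  container meets the random graph in more than \<open>s\<close> edges.  The lower bound on \<open>s\<close> excludes that
  the subgraph is \<open>F\<close>-free merely because it has fewer vertices than \<open>F\<close>.
\<close>

lemma prob_ex_le:
  fixes F :: "'a hypergraph" and s p :: real
  assumes F: "rgraph r F" "edges F \<noteq> {}"
    and p: "0 \<le> p" "p \<le> 1"
    and s: "2 ^ card (verts F) \<le> s"
    and cont: "containers {I. \<forall>e\<in>copies F ({..<n}, [{..<n}]\<^bsup>r\<^esup>). \<not> e \<subseteq> I} B
           (\<lambda>C. card C < m) ([{..<n}]\<^bsup>r\<^esup>)"
  shows "measure_pmf.prob (random_rgraph r n p) {G. real (ex G F) \<le> s} \<ge> 1 - B * exp (2 * p * m - s)"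
proof -
  let ?U = "[{..<n}]\<^bsup>r\<^esup>"
  let ?G = "\<lambda>X. ({..<n}, {e \<in> ?U. X e})"
  let ?P = "Pi_pmf ?U False (\<lambda>_. bernoulli_pmf p)"
  have U: "finite ?U" by (simp add: finite_imp_finite_nsets)
  obtain \<C> where fin: "finite \<C>" and card: "card \<C> \<le> B"
      and small: "\<forall>C\<in>\<C>. C \<subseteq> ?U \<and> card C < m"
      and cover: "\<forall>I\<in>{I. \<forall>e\<in>copies F ({..<n}, ?U). \<not> e \<subseteq> I}. I \<subseteq> ?U \<longrightarrow> (\<exists>C\<in>\<C>. I \<subseteq> C)"
    using cont unfolding containers_def by (elim exE conjE)
  have bad: "\<exists>C\<in>\<C>. s \<le> card {e\<in>C. X e}" if "\<not> real (ex (?G X) F) \<le> s" for X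
  proof -
    from that obtain G where G: "subgraph G (?G X)" "copies F G = {}" "s < card (edges G)"
      using ex_gtE[of "?G X" F s] F(2) by (auto simp: not_le)
    have sub: "verts G \<subseteq> {..<n}" "edges G \<subseteq> {e \<in> ?U. X e}" "edges G \<subseteq> Pow (verts G)"
      using G(1) by (auto simp: subgraph_def)
    have finG: "finite (verts G)" using sub(1) finite_subset by blast
    have "card (verts F) \<le> card (verts G)"
    proof (rule ccontr)
      assume *: "\<not> ?thesis"
      have "card (edges G) \<le> 2 ^ card (verts G)"
        using card_mono[OF _ sub(3)] finG by (simp add: card_Pow)
      also have "\<dots> \<le> 2 ^ card (verts F)" using * by (intro power_increasing) auto
      finally have "real (card (edges G)) \<le> 2 ^ card (verts F)" by (metis of_nat_le_iff of_nat_numeral of_nat_power)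
      then show False using s G(3) by linarith
    qed
    then have "\<not> e \<subseteq> edges G" if "e \<in> copies F ({..<n}, ?U)" for e
      using copies_nonempty_transfer[OF F(1) that finG sub(3)] G(2) by blast
    then have "edges G \<in> {I. \<forall>e\<in>copies F ({..<n}, ?U). \<not> e \<subseteq> I}" by blast
    moreover have "edges G \<subseteq> ?U" using sub(2) by auto
    ultimately obtain C where C: "C \<in> \<C>" "edges G \<subseteq> C" using cover by meson
    have "finite C" using small C(1) U finite_subset by meson
    then have "card (edges G) \<le> card {e\<in>C. X e}" using C(2) sub(2) by (intro card_mono) auto
    then show ?thesis using C(1) G(3) by (intro bexI[of _ C]) auto
  qed
  have "measure_pmf.prob (random_rgraph r n p) (- {G. real (ex G F) \<le> s})
      = measure_pmf.prob ?P {X. \<not> real (ex (?G X) F) \<le> s}"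
    unfolding random_rgraph_def measure_map_pmf by (simp add: vimage_def)
  also have "\<dots> \<le> measure_pmf.prob ?P (\<Union>C\<in>\<C>. {X. s \<le> card {e\<in>C. X e}})"
    using bad by (intro measure_pmf.finite_measure_mono) auto
  also have "\<dots> \<le> (\<Sum>C\<in>\<C>. measure_pmf.prob ?P {X. s \<le> card {e\<in>C. X e}})"
    using fin by (intro measure_pmf.finite_measure_subadditive_finite) auto
  also have "\<dots> \<le> card \<C> * exp (2 * p * m - s)"
  proof (rule sum_bounded_above)
    fix C assume C: "C \<in> \<C>"
    have "measure_pmf.prob ?P {X. s \<le> card {e\<in>C. X e}} \<le> exp (2 * p * card C - s)"
      using bspec[OF small C] U p by (intro prob_binomial_upper_tail) auto
    also have "\<dots> \<le> exp (2 * p * m - s)"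
      using bspec[OF small C] p by (auto intro!: mult_left_mono)
    finally show "measure_pmf.prob ?P {X. s \<le> card {e\<in>C. X e}} \<le> exp (2 * p * m - s)" .
  qed
  also have "\<dots> \<le> B * exp (2 * p * m - s)"
    using card by (intro mult_right_mono) auto
  finally show ?thesis
    by (subst (asm) measure_pmf.prob_compl[unfolded space_measure_pmf Compl_eq_Diff_UNIV[symmetric]]) auto
qed

theorem proposition2p6:
  fixes F :: "'a hypergraph" and r :: nat and C :: real
    and M :: "nat \<Rightarrow> real" and \<tau> :: "nat \<Rightarrow> nat \<Rightarrow> real"
  assumes "rgraph r F" and "r \<ge> 2" and "card (edges F) \<ge> 2"
    and "C > 0"
    and "\<And>n. n \<ge> 1 \<Longrightarrow> M n > 0"
    and "\<And>n m. n \<ge> 1 \<Longrightarrow> m \<ge> 1 \<Longrightarrow> \<tau> n m > 0"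
    and "balanced r F M (\<lambda>n. ln (real n) powr C) \<tau>"
    and "\<forall>\<^sub>F n in sequentially.
           (\<forall>m m'. M n \<le> real m \<and> m \<le> m' \<longrightarrow> \<tau> n m' \<le> \<tau> n m) \<and>
           (\<forall>m. M n \<le> real m \<longrightarrow> \<tau> n m \<ge> 1)"
  shows "\<exists>C'\<ge>0. \<forall>(m :: nat \<Rightarrow> nat) (p :: nat \<Rightarrow> real).
           (\<forall>\<^sub>F n in sequentially. real (m n) \<ge> M n \<and> 0 < p n \<and> p n \<le> 1) \<longrightarrow>
           filterlim (\<lambda>n. p n * real (m n)) at_top sequentially \<longrightarrow>
           (\<lambda>n. measure_pmf.prob (random_rgraph r n (p n))
              {G. real (ex G F)
                    \<le> max (C' * p n * real (m n)) (\<tau> n (m n) * ln (real n) powr C')})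
             \<longlonglongrightarrow> 1"
proof -
  define k where "k = card (edges F)"
  have "k \<ge> 1" using assms(3) by (simp add: k_def)
  from container_lemma[OF this, where 'a = "nat set"] obtain \<kappa> :: real where \<kappa>: "\<kappa> \<ge> 1"
    and container: "\<And>(V :: nat set set) b K w.
           finite V \<Longrightarrow> V \<noteq> {} \<Longrightarrow> b \<ge> 1 \<Longrightarrow> K > 0 \<Longrightarrow>
           uniform_weight V k w \<Longrightarrow> wdeg V w {} > 0 \<Longrightarrow> spread V b K w \<Longrightarrow>
           containers (edge_free w) ((card V + 1) ^ (b * (k - 1)))
             (\<lambda>C. card C \<le> (1 - 1 / (\<kappa> * K)) * card V) V"
    by blast
  have "edges F \<noteq> {}" using assms(3) by auto
  have numerics: "\<forall>\<^sub>F n in sequentially. \<exists>t :: nat.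
           (1 - 1 / (\<kappa> * ln (real n) powr C)) ^ t * real (n choose r) < 1 \<and>
           (\<forall>\<tau>\<ge>1. t * (nat \<lceil>\<tau>\<rceil> * (k - 1)) * ln (real (n choose r) + 1) \<le> \<tau> * ln (real n) powr (C + 8) / 4)"
    using assms(2,4) \<kappa> by (intro container_numerics) auto
  have ln_ge: "\<forall>\<^sub>F n in sequentially. 1 \<le> ln (real n)"
    using filterlim_compose[OF ln_at_top filterlim_real_sequentially]
    unfolding filterlim_at_top by blast
  show ?thesis
  proof (intro exI[of _ "C + 8"] conjI allI impI)
    show "0 \<le> C + 8" using assms(4) by simp
    fix m :: "nat \<Rightarrow> nat" and p :: "nat \<Rightarrow> real"
    assume mp: "\<forall>\<^sub>F n in sequentially. real (m n) \<ge> M n \<and> 0 < p n \<and> p n \<le> 1"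
      and lim: "filterlim (\<lambda>n. p n * real (m n)) at_top sequentially"
    define s where "s n = max ((C + 8) * p n * real (m n)) (\<tau> n (m n) * ln (real n) powr (C + 8))" for n
    let ?prob = "\<lambda>n. measure_pmf.prob (random_rgraph r n (p n)) {G. real (ex G F) \<le> s n}"
    have pm_ge: "\<forall>\<^sub>F n in sequentially. 2 ^ card (verts F) \<le> p n * real (m n)"
      using lim unfolding filterlim_at_top by blast
    have lower: "\<forall>\<^sub>F n in sequentially. 1 - exp (- (p n * real (m n))) \<le> ?prob n"
      using assms(7)[unfolded balanced_def] assms(8) numerics ln_ge mp pm_ge eventually_ge_at_top[of 1]
    proof eventually_elim
      case (elim n)
      define \<gamma> b where "\<gamma> = ln (real n) powr C" and "b = nat \<lceil>\<tau> n (m n)\<rceil>"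
      from elim(3) obtain t :: nat where t: "(1 - 1 / (\<kappa> * \<gamma>)) ^ t * real (n choose r) < 1"
        "\<And>\<tau>. \<tau> \<ge> 1 \<Longrightarrow> t * (nat \<lceil>\<tau>\<rceil> * (k - 1)) * ln (real (n choose r) + 1) \<le> \<tau> * ln (real n) powr (C + 8) / 4"
        unfolding \<gamma>_def by blast
      have n: "n \<ge> 1" and m: "M n \<le> real (m n)" and p: "0 < p n" "p n \<le> 1" using elim(5,7) by auto
      have "m n \<ge> 1" using m assms(5)[OF n] by (cases "m n") auto
      have \<tau>: "\<tau> n (m n) \<ge> 1" using elim(2) m by blast
      have \<gamma>: "\<gamma> \<ge> 1" using elim(4) assms(4) by (simp add: \<gamma>_def ge_one_powr_ge_zero)
      have \<tau>b: "0 < \<tau> n m' \<and> \<tau> n m' \<le> real b" if "m' \<ge> m n" for m'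
      proof -
        have "\<tau> n m' \<le> \<tau> n (m n)" using elim(2) m that by blast
        also have "\<dots> \<le> real b" unfolding b_def by linarith
        finally show ?thesis using assms(6)[OF n] that \<open>m n \<ge> 1\<close> by auto
      qed
      define B where "B = (((n choose r) + 1) ^ (b * (k - 1))) ^ t"
      have "containers {I. \<forall>e\<in>copies F ({..<n}, [{..<n}]\<^bsup>r\<^esup>). \<not> e \<subseteq> I} B
           (\<lambda>C. card C < m n) ([{..<n}]\<^bsup>r\<^esup>)"
        unfolding B_def k_def
      proof (rule small_containers_of_balanced[OF assms(1) _ m \<open>m n \<ge> 1\<close> _ \<tau>b \<gamma> \<kappa> _ t(1)])
        show "b \<ge> 1" using \<tau> unfolding b_def by linarith
      qed (use elim(1) container in \<open>auto simp: \<gamma>_def k_def\<close>)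
      \<comment> \<open>The exponent \<open>2 * p * m\<close> of the tail bound and the logarithm of the number of containers
        are each at most \<open>s / 4\<close>, which leaves \<open>exp (- s / 2)\<close>.\<close>
      moreover have s8: "8 * (p n * real (m n)) \<le> s n"
      proof -
        have "8 * (p n * real (m n)) \<le> (C + 8) * (p n * real (m n))"
          using p assms(4) by (intro mult_right_mono) auto
        then show ?thesis by (simp add: s_def mult.assoc)
      qed
      have "0 \<le> p n * real (m n)" using p by simp
      then have "2 ^ card (verts F) \<le> s n" using elim(6) s8 by linarith
      ultimately have *: "1 - B * exp (2 * p n * m n - s n) \<le> ?prob n"
        using p assms(1) \<open>edges F \<noteq> {}\<close> by (intro prob_ex_le) auto
      have "real B = exp (t * (b * (k - 1)) * ln (real (n choose r) + 1))"
      proof -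
        have "real B = (real (n choose r) + 1) ^ (t * (b * (k - 1)))"
          by (simp add: B_def power_mult[symmetric] mult.commute add.commute)
        also have "\<dots> = exp (ln (real (n choose r) + 1)) ^ (t * (b * (k - 1)))" by simp
        also have "\<dots> = exp (t * (b * (k - 1)) * ln (real (n choose r) + 1))"
          by (simp only: exp_of_nat_mult[symmetric] of_nat_mult)
        finally show ?thesis .
      qed
      also have "\<dots> \<le> exp (s n / 4)"
        using t(2)[OF \<tau>] by (simp add: s_def b_def)
      finally have "B * exp (2 * p n * m n - s n) \<le> exp (s n / 4) * exp (2 * p n * m n - s n)"
        by (intro mult_right_mono) auto
      also have "\<dots> \<le> exp (- (p n * real (m n)))"
        using s8 \<open>0 \<le> p n * real (m n)\<close> by (simp add: exp_add[symmetric])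
      finally show ?case using * by linarith
    qed
    have "(\<lambda>n. exp (- (p n * real (m n)))) \<longlonglongrightarrow> 0"
      by (rule filterlim_compose[OF exp_at_bot])
         (use lim in \<open>simp add: filterlim_uminus_at_bot\<close>)
    then have "(\<lambda>n. 1 - exp (- (p n * real (m n)))) \<longlonglongrightarrow> 1 - 0"
      by (intro tendsto_diff tendsto_const)
    then have "(\<lambda>n. 1 - exp (- (p n * real (m n)))) \<longlonglongrightarrow> 1" by simp
    moreover have "\<forall>\<^sub>F n in sequentially. ?prob n \<le> 1" by (simp add: measure_pmf.prob_le_1)
    ultimately have "?prob \<longlonglongrightarrow> 1"
      using tendsto_sandwich[OF lower, of "\<lambda>_. 1" 1] by simp
    then show "(\<lambda>n. measure_pmf.prob (random_rgraph r n (p n))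
              {G. real (ex G F)
                    \<le> max ((C + 8) * p n * real (m n)) (\<tau> n (m n) * ln (real n) powr (C + 8))})
             \<longlonglongrightarrow> 1" unfolding s_def .
  qed
qed

end
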